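(* Consider the single-frequency RoPE self-attention phase flow on the circle ($d=2$) with $n\ge2$ tokens, arbitrary fixed positions $p_i\in\mathbb{R}$, frequency $\omega\in\mathbb{R}$ and finite $\beta\ge0$, and put $\underline a=\dfrac{1}{1+(n-1)e^{2\beta}}$. Choose continuous lifts $\theta_i(t)\in\mathbb{R}$ of the phases of a solution, and let $D(t)=\max_i\theta_i(t)-\min_i\theta_i(t)$ be the lifted diameter. If $$D_0=D(0)=\max_i\theta_i(0)-\min_i\theta_i(0)<\pi,$$ then for all $t\ge0$ the lifted diameter remains below $\pi$ and satisfies $$D^{+}D(t)\le-2\underline a\sin D(t),\qquad \tan\frac{D(t)}2\le\tan\frac{D_0}2\,e^{-2\underline a t}.$$
   Context: Phase flow: with $x_i=(\cos\theta_i,\sin\theta_i)\in\mathbb{S}^1$, let $W_{ij}=\exp\bigl(\beta\cos(\theta_i-\theta_j+\omega(p_i-p_j))\bigr)$, $A_{ij}=W_{ij}/\sum_kW_{ik}$, and $\dot\theta_i=\sum_{j=1}^nA_{ij}(\theta)\sin(\theta_j-\theta_i)$. Solutions exist globally and are unique. $D^+f(t)=\limsup_{h\downarrow0}\frac{f(t+h)-f(t)}{h}$ is the upper right Dini derivative. *)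

theory Defs
  imports "HOL-Analysis.Analysis"
begin

text \<open>
  Tokens are indexed by \<open>{..<n}\<close>; values of index-dependent functions outside this range
  are irrelevant.  Phases are real numbers, with token \<open>i\<close> sitting at
  \<open>circle_point (\<theta> i)\<close> on the unit circle.
\<close>

definition circle_point :: "real \<Rightarrow> real \<times> real" where
  "circle_point a = (cos a, sin a)"

definition rope_weight ::
    "real \<Rightarrow> real \<Rightarrow> (nat \<Rightarrow> real) \<Rightarrow> (nat \<Rightarrow> real) \<Rightarrow> nat \<Rightarrow> nat \<Rightarrow> real" where
  "rope_weight \<beta> \<omega> p \<theta> i j = exp (\<beta> * cos (\<theta> i - \<theta> j + \<omega> * (p i - p j)))"

definition rope_attention ::
    "nat \<Rightarrow> real \<Rightarrow> real \<Rightarrow> (nat \<Rightarrow> real) \<Rightarrow> (nat \<Rightarrow> real) \<Rightarrow> nat \<Rightarrow> nat \<Rightarrow> real" where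
  "rope_attention n \<beta> \<omega> p \<theta> i j =
     rope_weight \<beta> \<omega> p \<theta> i j / (\<Sum>k<n. rope_weight \<beta> \<omega> p \<theta> i k)"

text \<open>Global forward solutions; the derivative at time 0 is one-sided.\<close>

definition phase_flow_solution ::
    "nat \<Rightarrow> real \<Rightarrow> real \<Rightarrow> (nat \<Rightarrow> real) \<Rightarrow> (nat \<Rightarrow> real \<Rightarrow> real) \<Rightarrow> bool" where
  "phase_flow_solution n \<beta> \<omega> p \<phi> \<longleftrightarrow>
     (\<forall>i<n. \<forall>t\<ge>0.
        (\<phi> i has_real_derivative
           (\<Sum>j<n. rope_attention n \<beta> \<omega> p (\<lambda>k. \<phi> k t) i j * sin (\<phi> j t - \<phi> i t)))
        (at t within {0..}))"

text \<open>
  Continuous lifts of the circle-valued trajectories \<open>x i t\<close>.  Any choice of branch is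
  allowed, independently for each token.
\<close>

definition continuous_lifts ::
    "nat \<Rightarrow> (nat \<Rightarrow> real \<Rightarrow> real \<times> real) \<Rightarrow> (nat \<Rightarrow> real \<Rightarrow> real) \<Rightarrow> bool" where
  "continuous_lifts n x \<theta> \<longleftrightarrow>
     (\<forall>i<n. continuous_on {0..} (\<theta> i) \<and> (\<forall>t\<ge>0. circle_point (\<theta> i t) = x i t))"

definition lifted_diameter :: "nat \<Rightarrow> (nat \<Rightarrow> real \<Rightarrow> real) \<Rightarrow> real \<Rightarrow> real" where
  "lifted_diameter n \<theta> t = Max ((\<lambda>i. \<theta> i t) ` {..<n}) - Min ((\<lambda>i. \<theta> i t) ` {..<n})"

text \<open>The upper right Dini derivative may be infinite, hence the extended reals.\<close>

definition upper_right_dini :: "(real \<Rightarrow> real) \<Rightarrow> real \<Rightarrow> ereal" where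
  "upper_right_dini f t = Limsup (at_right 0) (\<lambda>h. ereal ((f (t + h) - f t) / h))"

definition attention_floor :: "nat \<Rightarrow> real \<Rightarrow> real" where
  "attention_floor n \<beta> = 1 / (1 + (real n - 1) * exp (2 * \<beta>))"

end

theory Submission imports Defs begin

text \<open>
  The diameter is the maximum over pairs of the differentiable functions
  \<open>\<theta> i - \<theta> j\<close>.  Suppose the pair \<open>(i, j)\<close> realises it and its value \<open>D\<close> is below \<open>pi\<close>.
  Then every token lies on the arc from \<open>j\<close> to \<open>i\<close>, so every term of the velocity of \<open>i\<close>
  is nonpositive and every term of the velocity of \<open>j\<close> is nonnegative: nobody pushes the
  extreme tokens outwards.  Keeping only the mutual attraction of \<open>i\<close> and \<open>j\<close>, whose
  attention coefficients are at least the floor \<open>a\<close> whatever the positions are, gives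
  \<open>\<theta> i' - \<theta> j' \<le> - 2 a sin D\<close> (\<open>extreme_pair_contracts\<close>).

  The Dini inequality follows, since only the pairs that realise the maximum matter for its
  upper right derivative (\<open>upper_right_dini_Max_le\<close>).

  That argument presupposes \<open>D < pi\<close>, so it cannot by itself be integrated along the flow.
  Instead the diameter is compared with the function \<open>2 arctan (K exp (- c t))\<close>, a
  solution of \<open>u' = - c sin u\<close> that never reaches \<open>pi\<close>.  If \<open>c < 2 a\<close> and
  \<open>K > tan (D 0 / 2)\<close>, the diameter starts strictly below \<open>u\<close>, and at a first contact the
  touching pair would move down strictly faster than \<open>u\<close>, hence would have been above \<open>u\<close>
  shortly before (\<open>finite_family_below_barrier\<close>).  So the diameter stays below \<open>u\<close>, hence
  below \<open>pi\<close>, and \<open>c \<rightarrow> 2 a\<close>, \<open>K \<rightarrow> tan (D 0 / 2)\<close> give the exponential bound.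

  All of this is about a lift that itself solves the flow.  Any continuous lift does, because
  it differs from the given solution by constant multiples of \<open>2 pi\<close>, which the velocity
  field does not see.
\<close>

section \<open>Finite maxima of differentiable functions\<close>

text \<open>
  Functions below the maximum at \<open>t\<close> stay below it for a short time by continuity, so only
  those that attain it contribute.
\<close>

lemma upper_right_dini_Max_le:
  fixes f :: "'k \<Rightarrow> real \<Rightarrow> real"
  assumes fin: "finite I" "I \<noteq> {}"
    and der: "\<And>k. k \<in> I \<Longrightarrow> (f k has_real_derivative d k) (at_right t)"
    and act: "\<And>k. \<lbrakk>k \<in> I; \<And>l. l \<in> I \<Longrightarrow> f l t \<le> f k t\<rbrakk> \<Longrightarrow> d k \<le> c"
  shows "upper_right_dini (\<lambda>s. Max ((\<lambda>k. f k s) ` I)) t \<le> ereal c"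
proof -
  define F where "F s = Max ((\<lambda>k. f k s) ` I)" for s
  have F_ge: "f k s \<le> F s" if "k \<in> I" for k s
    unfolding F_def using fin that by auto
  have slope: "\<forall>\<^sub>F h in at_right 0. (F (t + h) - F t) / h < e" if e: "c < e" for e
  proof -
    have "\<forall>\<^sub>F s in at_right t. f k s < F t + e * (s - t)" if k: "k \<in> I" for k
    proof (cases "f k t = F t")
      case True
      have "d k < e"
        using act[OF k] F_ge True e by fastforce
      moreover have "((\<lambda>s. (f k s - f k t) / (s - t)) \<longlongrightarrow> d k) (at_right t)"
        using der[OF k] by (simp add: has_field_derivative_iff)
      ultimately have "\<forall>\<^sub>F s in at_right t. (f k s - f k t) / (s - t) < e"
        by (simp add: order_tendstoD)
      then show ?thesis
        using eventually_at_right_less[of t]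
        by eventually_elim (simp add: True divide_simps algebra_simps)
    next
      case False
      then have "f k t < F t"
        using F_ge[OF k, of t] by simp
      moreover have "(f k \<longlongrightarrow> f k t) (at_right t)"
        using DERIV_continuous[OF der[OF k]] by (simp add: continuous_within)
      then have "((\<lambda>s. f k s - e * (s - t)) \<longlongrightarrow> f k t - e * (t - t)) (at_right t)"
        by (intro tendsto_intros)
      ultimately have "\<forall>\<^sub>F s in at_right t. f k s - e * (s - t) < F t"
        by (intro order_tendstoD) auto
      then show ?thesis
        by eventually_elim simp
    qed
    then have "\<forall>\<^sub>F s in at_right t. \<forall>k\<in>I. f k s < F t + e * (s - t)"
      using fin by (simp add: eventually_ball_finite)
    then have "\<forall>\<^sub>F s in at_right t. F s < F t + e * (s - t)"
      by eventually_elim (use fin in \<open>simp add: F_def\<close>)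
    then have "\<forall>\<^sub>F h in at_right 0. F (h + t) < F t + e * h"
      by (subst (asm) at_right_to_0) (simp add: eventually_filtermap)
    then show ?thesis
      using eventually_at_right_less[of 0]
      by eventually_elim (simp add: divide_simps algebra_simps)
  qed
  have "Limsup (at_right 0) (\<lambda>h. ereal ((F (t + h) - F t) / h)) \<le> ereal c"
    unfolding Limsup_le_iff
  proof (intro allI impI)
    fix y :: ereal assume "ereal c < y"
    then show "\<forall>\<^sub>F h in at_right 0. ereal ((F (t + h) - F t) / h) < y"
      using slope by (cases y) auto
  qed
  then show ?thesis
    by (simp add: upper_right_dini_def F_def)
qed

text \<open>
  At the earliest contact time some member of the family touches the barrier \<open>u\<close>.  Its
  difference to \<open>u\<close> has negative derivative there, hence was positive just before, against
  minimality of the contact time.  In \<open>contact\<close> the whole family may be assumed to lie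
  below \<open>u\<close>: for phase differences this says that the touching pair is an extreme one,
  and contraction holds for extreme pairs, not for arbitrary ones.
\<close>

lemma finite_family_below_barrier:
  fixes f :: "'k \<Rightarrow> real \<Rightarrow> real"
  assumes fin: "finite I"
    and der: "\<And>k t. \<lbrakk>k \<in> I; t \<ge> 0\<rbrakk> \<Longrightarrow> (f k has_real_derivative d k t) (at t within {0..})"
    and der_u: "\<And>t. (u has_real_derivative u' t) (at t)"
    and init: "\<And>k. k \<in> I \<Longrightarrow> f k 0 < u 0"
    and contact: "\<And>k t. \<lbrakk>k \<in> I; t \<ge> 0; f k t = u t; \<And>l. l \<in> I \<Longrightarrow> f l t \<le> u t\<rbrakk>
                    \<Longrightarrow> d k t < u' t"
    and k: "k \<in> I" and t: "t \<ge> 0"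
  shows "f k t < u t"
proof (rule ccontr)
  assume "\<not> f k t < u t"
  define S where "S = (\<Union>k\<in>I. {t \<in> {0..}. u t \<le> f k t})"
  have cont_u: "continuous_on {0..} u"
    using der_u by (meson DERIV_continuous_on has_field_derivative_at_within)
  have cont_f: "continuous_on {0..} (f l)" if "l \<in> I" for l
    using der[OF that] by (auto intro!: DERIV_continuous_on)
  have "closed S"
    unfolding S_def using fin cont_u cont_f
    by (intro closed_UN ballI continuous_on_closed_Collect_le) auto
  moreover have "t \<in> S"
    using k t \<open>\<not> f k t < u t\<close> by (force simp: S_def not_less)
  moreover have bdd: "bdd_below S"
    unfolding S_def by (rule bdd_belowI[of _ 0]) auto
  ultimately have "Inf S \<in> S"
    by (intro closed_contains_Inf) auto
  then obtain m where m: "m \<in> I" "Inf S \<ge> 0" "u (Inf S) \<le> f m (Inf S)"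
    by (auto simp: S_def)
  define \<tau> where "\<tau> = Inf S"
  have "\<tau> > 0"
    using m init[of m] by (cases "\<tau> = 0") (auto simp: \<tau>_def)
  have before: "f l s < u s" if "l \<in> I" "0 \<le> s" "s < \<tau>" for l s
    using that cInf_lower[OF _ bdd, of s] by (force simp: S_def \<tau>_def)
  have upto: "f l \<tau> \<le> u \<tau>" if l: "l \<in> I" for l
  proof -
    have "\<tau> islimpt {0..<\<tau>}" using \<open>\<tau> > 0\<close>
      by (simp add: islimpt_in_closure)
    then have nontriv: "at \<tau> within {0..<\<tau>} \<noteq> bot"
      by (simp add: trivial_limit_within)
    have lim: "(g \<longlongrightarrow> g \<tau>) (at \<tau> within {0..<\<tau>})" if "continuous_on {0..} g" for g :: "real \<Rightarrow> real"
    proof (rule tendsto_within_subset)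
      show "(g \<longlongrightarrow> g \<tau>) (at \<tau> within {0..})"
        using that \<open>\<tau> > 0\<close> by (simp add: continuous_on_def)
    qed auto
    have "\<forall>\<^sub>F s in at \<tau> within {0..<\<tau>}. f l s \<le> u s"
      unfolding eventually_at_filter
      using before[OF l] by (intro always_eventually) (simp add: less_imp_le)
    then show ?thesis
      by (rule tendsto_le[OF nontriv lim[OF cont_u] lim[OF cont_f[OF l]]])
  qed
  have "f m \<tau> = u \<tau>"
    using upto[of m] m by (simp add: \<tau>_def)
  then have "d m \<tau> - u' \<tau> < 0"
    using contact[of m \<tau>] m upto \<open>\<tau> > 0\<close> by simp
  moreover have "((\<lambda>s. f m s - u s) has_real_derivative (d m \<tau> - u' \<tau>)) (at \<tau> within {0..})"
    using \<open>\<tau> > 0\<close> m(1) by (intro DERIV_diff der has_field_derivative_at_within[OF der_u]) simp_all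
  ultimately obtain e where e: "e > 0"
      "\<And>h. \<lbrakk>h > 0; \<tau> - h \<in> {0..}; h < e\<rbrakk> \<Longrightarrow> f m \<tau> - u \<tau> < f m (\<tau> - h) - u (\<tau> - h)"
    using has_real_derivative_neg_dec_left[of "\<lambda>s. f m s - u s" "d m \<tau> - u' \<tau>" \<tau> "{0..}"]
    by auto
  define h where "h = min \<tau> e / 2"
  have "h > 0" "h \<le> \<tau>" "h < e"
    using \<open>\<tau> > 0\<close> e(1) by (auto simp: h_def min_def)
  then show False
    using e(2)[of h] before[of m "\<tau> - h"] m(1) \<open>f m \<tau> = u \<tau>\<close> by simp
qed

section \<open>Continuous lifts solve the phase flow\<close>

text \<open>
  The difference of two lifts takes values in the discrete set of multiples of \<open>2 pi\<close>, hence
  is constant on a connected set.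
\<close>

lemma circle_lifts_differ_by_constant:
  fixes f g :: "real \<Rightarrow> real"
  assumes "connected S" "continuous_on S f" "continuous_on S g"
    and eq: "\<And>t. t \<in> S \<Longrightarrow> circle_point (f t) = circle_point (g t)"
  obtains m :: int where "\<And>t. t \<in> S \<Longrightarrow> f t = g t + 2 * pi * m"
proof -
  have lattice: "\<exists>m::int. f t - g t = 2 * pi * m" if "t \<in> S" for t
    using eq[OF that] sin_cos_eq_iff[of "f t" "g t"]
    by (auto simp: circle_point_def algebra_simps)
  have "(\<lambda>t. f t - g t) constant_on S"
  proof (rule continuous_discrete_range_constant[OF \<open>connected S\<close>])
    show "continuous_on S (\<lambda>t. f t - g t)"
      using assms by (intro continuous_intros)
    fix x assume x: "x \<in> S"
    show "\<exists>e>0. \<forall>y. y \<in> S \<and> f y - g y \<noteq> f x - g x \<longrightarrow> e \<le> norm (f y - g y - (f x - g x))"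
    proof (intro exI[of _ "2 * pi"] conjI allI impI)
      fix y assume y: "y \<in> S \<and> f y - g y \<noteq> f x - g x"
      obtain k l :: int where kl: "f y - g y = 2 * pi * k" "f x - g x = 2 * pi * l"
        using lattice x y by blast
      then have "\<bar>k - l\<bar> \<ge> 1"
        using y by auto
      then have "1 \<le> \<bar>real_of_int k - real_of_int l\<bar>"
        by linarith
      moreover have "norm (f y - g y - (f x - g x)) = 2 * pi * \<bar>real_of_int k - real_of_int l\<bar>"
        by (simp add: kl abs_mult flip: right_diff_distrib)
      ultimately show "2 * pi \<le> norm (f y - g y - (f x - g x))"
        by simp
    qed simp
  qed
  then obtain c where c: "\<And>t. t \<in> S \<Longrightarrow> f t - g t = c"
    by (auto simp: constant_on_def)
  show ?thesis
  proof (cases "S = {}")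
    case False
    then obtain m :: int where "c = 2 * pi * m"
      using lattice c by (metis all_not_in_conv)
    then show ?thesis
      using c that[of m] by (metis add.commute diff_add_cancel)
  qed (use that in blast)
qed

definition phase_velocity ::
    "nat \<Rightarrow> real \<Rightarrow> real \<Rightarrow> (nat \<Rightarrow> real) \<Rightarrow> (nat \<Rightarrow> real) \<Rightarrow> nat \<Rightarrow> real" where
  "phase_velocity n \<beta> \<omega> p x i =
     (\<Sum>j<n. rope_attention n \<beta> \<omega> p x i j * sin (x j - x i))"

lemma phase_velocity_periodic:
  fixes m :: "nat \<Rightarrow> int"
  assumes y: "\<And>k. k < n \<Longrightarrow> y k = x k + 2 * pi * m k" and i: "i < n"
  shows "phase_velocity n \<beta> \<omega> p y i = phase_velocity n \<beta> \<omega> p x i"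
proof -
  have shift: "sin (a + 2 * pi * of_int k) = sin a \<and> cos (a + 2 * pi * of_int k) = cos a"
    for a and k :: int
    using sin_cos_eq_iff by blast
  have weight: "rope_weight \<beta> \<omega> p y i j = rope_weight \<beta> \<omega> p x i j" if "j < n" for j
    using shift[of "x i - x j + \<omega> * (p i - p j)" "m i - m j"] y[OF i] y[OF that]
    by (simp add: rope_weight_def algebra_simps)
  have "sin (y j - y i) = sin (x j - x i)" if "j < n" for j
    using shift[of "x j - x i" "m j - m i"] y[OF i] y[OF that]
    by (simp add: algebra_simps)
  with weight show ?thesis
    by (simp add: phase_velocity_def rope_attention_def)
qed

lemma continuous_lift_solves_phase_flow:
  assumes sol: "phase_flow_solution n \<beta> \<omega> p \<phi>"
    and lift: "continuous_lifts n (\<lambda>i t. circle_point (\<phi> i t)) \<theta>"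
  shows "phase_flow_solution n \<beta> \<omega> p \<theta>"
proof -
  have der: "(\<phi> i has_real_derivative phase_velocity n \<beta> \<omega> p (\<lambda>k. \<phi> k t) i) (at t within {0..})"
    if "i < n" "t \<ge> 0" for i t
    using sol that by (simp add: phase_flow_solution_def phase_velocity_def)
  have "\<exists>m::int. \<forall>t\<ge>0. \<theta> i t = \<phi> i t + 2 * pi * m" if i: "i < n" for i
  proof -
    have "continuous_on {0..} (\<phi> i)"
      using der[OF i] by (auto intro!: DERIV_continuous_on)
    then show ?thesis
      using lift i circle_lifts_differ_by_constant[of "{0..}" "\<theta> i" "\<phi> i"]
      unfolding continuous_lifts_def
      by (metis atLeast_iff connected_Ici)
  qed
  then obtain m :: "nat \<Rightarrow> int" where
    m: "\<And>i t. \<lbrakk>i < n; t \<ge> 0\<rbrakk> \<Longrightarrow> \<theta> i t = \<phi> i t + 2 * pi * m i"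
    by metis
  have "(\<theta> i has_real_derivative phase_velocity n \<beta> \<omega> p (\<lambda>k. \<theta> k t) i) (at t within {0..})"
    if "i < n" "t \<ge> 0" for i t
  proof -
    have "((\<lambda>t. \<phi> i t + 2 * pi * m i) has_real_derivative
             phase_velocity n \<beta> \<omega> p (\<lambda>k. \<phi> k t) i) (at t within {0..})"
      using DERIV_add[OF der[OF that] DERIV_const] by simp
    moreover have "phase_velocity n \<beta> \<omega> p (\<lambda>k. \<theta> k t) i = phase_velocity n \<beta> \<omega> p (\<lambda>k. \<phi> k t) i"
      using that m by (intro phase_velocity_periodic) auto
    ultimately show ?thesis
      using that m
      by (auto intro: has_field_derivative_transform_within[where d = 1])
  qed
  then show ?thesis
    by (simp add: phase_flow_solution_def phase_velocity_def)
qed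

section \<open>Contraction of the extreme pair\<close>

text \<open>
  A weight lies between \<open>exp (- \<beta>)\<close> and \<open>exp \<beta>\<close>, so each of the other \<open>n - 1\<close> weights is at
  most \<open>exp (2 * \<beta>)\<close> times the given one.
\<close>

lemma attention_floor_le:
  assumes "\<beta> \<ge> 0" "j < n"
  shows "attention_floor n \<beta> \<le> rope_attention n \<beta> \<omega> p x i j"
proof -
  define w where "w k = rope_weight \<beta> \<omega> p x i k" for k
  have w_pos: "w k > 0" for k
    by (simp add: w_def rope_weight_def)
  have ratio: "w k \<le> exp (2 * \<beta>) * w j" for k
  proof -
    have "\<beta> * cos a \<le> 2 * \<beta> + \<beta> * cos b" for a b
      using mult_left_mono[OF cos_le_one[of a] assms(1)]
        mult_left_mono[OF cos_ge_minus_one[of b] assms(1)] by simp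
    then show ?thesis
      by (simp add: w_def rope_weight_def flip: exp_add)
  qed
  have "(\<Sum>k<n. w k) = w j + (\<Sum>k\<in>{..<n} - {j}. w k)"
    using assms(2) by (simp add: sum.remove)
  also have "(\<Sum>k\<in>{..<n} - {j}. w k) \<le> (\<Sum>k\<in>{..<n} - {j}. exp (2 * \<beta>) * w j)"
    using ratio by (intro sum_mono)
  also have "\<dots> = (real n - 1) * (exp (2 * \<beta>) * w j)"
    using assms(2) by (simp add: of_nat_diff)
  finally have le: "(\<Sum>k<n. w k) \<le> (1 + (real n - 1) * exp (2 * \<beta>)) * w j"
    by (simp add: algebra_simps)
  have "(\<Sum>k<n. w k) > 0"
    using w_pos assms(2) by (intro sum_pos) auto
  moreover have "1 + (real n - 1) * exp (2 * \<beta>) > 0"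
    using assms(2) by (intro add_pos_nonneg mult_nonneg_nonneg) auto
  ultimately show ?thesis
    using le by (simp add: attention_floor_def rope_attention_def divide_simps mult.commute
        flip: w_def)
qed

lemma attention_floor_pos: "n \<ge> 1 \<Longrightarrow> attention_floor n \<beta> > 0"
  by (auto simp: attention_floor_def intro!: add_pos_nonneg mult_nonneg_nonneg)

text \<open>
  The pair spans all tokens within less than half a turn, so all the sines in both
  velocities have the contracting sign, and in each velocity the term of the opposite
  extreme token alone already gives half of the bound.
\<close>

lemma extreme_pair_contracts:
  assumes "\<beta> \<ge> 0" "i < n" "j < n"
    and span: "\<And>k l. \<lbrakk>k < n; l < n\<rbrakk> \<Longrightarrow> x k - x l \<le> x i - x j" "x i - x j < pi"
  shows "phase_velocity n \<beta> \<omega> p x i - phase_velocity n \<beta> \<omega> p x j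
           \<le> - 2 * attention_floor n \<beta> * sin (x i - x j)"
proof -
  let ?a = "attention_floor n \<beta>"
  let ?A = "rope_attention n \<beta> \<omega> p x"
  have floor: "?a \<le> ?A k l" if "l < n" for k l
    using attention_floor_le[OF assms(1) that] .
  have A_nonneg: "0 \<le> ?A k l" if "l < n" for k l
    using floor[OF that, of k] attention_floor_pos[of n \<beta>] that by simp
  have below: "x k \<le> x i" and above: "x j \<le> x k" if "k < n" for k
    using span(1)[OF that assms(3)] span(1)[OF assms(2) that] by auto
  have sin_i: "0 \<le> sin (x i - x k)" and sin_j: "0 \<le> sin (x k - x j)" if "k < n" for k
    using below[OF that] above[OF that] span(2) by (auto intro!: sin_ge_zero)
  have "?a * sin (x i - x j) \<le> ?A i j * sin (x i - x j)"
    using floor[OF assms(3)] sin_i[OF assms(3)] by (rule mult_right_mono)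
  also have "\<dots> \<le> (\<Sum>k<n. ?A i k * sin (x i - x k))"
    using assms A_nonneg sin_i
    by (intro member_le_sum[where f = "\<lambda>k. ?A i k * sin (x i - x k)"]) auto
  also have "\<dots> = - phase_velocity n \<beta> \<omega> p x i"
    by (simp add: phase_velocity_def sin_diff algebra_simps flip: sum_negf)
  finally have vi: "?a * sin (x i - x j) \<le> - phase_velocity n \<beta> \<omega> p x i" .
  have "?a * sin (x i - x j) \<le> ?A j i * sin (x i - x j)"
    using floor[OF assms(2)] sin_i[OF assms(3)] by (rule mult_right_mono)
  also have "\<dots> \<le> phase_velocity n \<beta> \<omega> p x j"
    unfolding phase_velocity_def using assms A_nonneg sin_j
    by (intro member_le_sum[where f = "\<lambda>k. ?A j k * sin (x k - x j)"]) auto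
  finally show ?thesis
    using vi by simp
qed

section \<open>Decay of the lifted diameter\<close>

lemma lifted_diameter_eq_Max_pairs:
  assumes "n > 0"
  shows "lifted_diameter n \<theta> t = Max ((\<lambda>(i, j). \<theta> i t - \<theta> j t) ` ({..<n} \<times> {..<n}))"
proof -
  let ?X = "(\<lambda>i. \<theta> i t) ` {..<n}"
  have X: "finite ?X" "?X \<noteq> {}"
    using assms by auto
  obtain i where i: "i < n" "Max ?X = \<theta> i t"
    using Max_in[OF X] by auto
  obtain j where j: "j < n" "Min ?X = \<theta> j t"
    using Min_in[OF X] by auto
  show ?thesis
    unfolding lifted_diameter_def
  proof (rule Max_eqI[symmetric])
    fix y assume "y \<in> (\<lambda>(i, j). \<theta> i t - \<theta> j t) ` ({..<n} \<times> {..<n})"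
    then obtain k l where kl: "k < n" "l < n" "y = \<theta> k t - \<theta> l t"
      by auto
    have "\<theta> k t \<le> Max ?X" "Min ?X \<le> \<theta> l t"
      using kl X by auto
    then show "y \<le> Max ?X - Min ?X"
      unfolding kl(3) by (rule diff_mono)
  next
    show "Max ?X - Min ?X \<in> (\<lambda>(i, j). \<theta> i t - \<theta> j t) ` ({..<n} \<times> {..<n})"
      unfolding i j using i(1) j(1) by force
  qed simp
qed

lemma phase_difference_le_lifted_diameter:
  assumes "i < n" "j < n"
  shows "\<theta> i t - \<theta> j t \<le> lifted_diameter n \<theta> t"
  unfolding lifted_diameter_def using assms by (intro diff_mono Max_ge Min_le) auto

lemma lifted_diameter_attained:
  assumes "n > 0"
  obtains i j where "i < n" "j < n" "lifted_diameter n \<theta> t = \<theta> i t - \<theta> j t"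
proof -
  have "lifted_diameter n \<theta> t \<in> (\<lambda>(i, j). \<theta> i t - \<theta> j t) ` ({..<n} \<times> {..<n})"
    unfolding lifted_diameter_eq_Max_pairs[OF assms] using assms by (intro Max_in) auto
  then show ?thesis
    using that by auto
qed

lemma lifted_diameter_nonneg: "n > 0 \<Longrightarrow> 0 \<le> lifted_diameter n \<theta> t"
  using phase_difference_le_lifted_diameter[of 0 n 0 \<theta> t] by simp

lemma phase_difference_derivative:
  assumes "phase_flow_solution n \<beta> \<omega> p \<theta>" "i < n" "j < n" "t \<ge> 0"
  shows "((\<lambda>t. \<theta> i t - \<theta> j t) has_real_derivative
            (phase_velocity n \<beta> \<omega> p (\<lambda>k. \<theta> k t) i - phase_velocity n \<beta> \<omega> p (\<lambda>k. \<theta> k t) j))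
          (at t within {0..})"
  using assms unfolding phase_flow_solution_def phase_velocity_def
  by (intro DERIV_diff) auto

lemma lifted_diameter_dini_le:
  assumes "\<beta> \<ge> 0" "n > 0" and sol: "phase_flow_solution n \<beta> \<omega> p \<theta>" and "t \<ge> 0"
    and small: "lifted_diameter n \<theta> t < pi"
  shows "upper_right_dini (lifted_diameter n \<theta>) t
           \<le> ereal (- 2 * attention_floor n \<beta> * sin (lifted_diameter n \<theta> t))"
proof -
  let ?v = "phase_velocity n \<beta> \<omega> p (\<lambda>k. \<theta> k t)"
  let ?I = "{..<n} \<times> {..<n}"
  have "upper_right_dini (\<lambda>s. Max ((\<lambda>k. (case k of (i, j) \<Rightarrow> \<lambda>s. \<theta> i s - \<theta> j s) s) ` ?I)) t
          \<le> ereal (- 2 * attention_floor n \<beta> * sin (lifted_diameter n \<theta> t))"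
  proof (rule upper_right_dini_Max_le[where d = "\<lambda>(i, j). ?v i - ?v j"])
    fix k assume "k \<in> ?I"
    then obtain i j where k: "k = (i, j)" and ij: "i < n" "j < n"
      by auto
    have "((\<lambda>s. \<theta> i s - \<theta> j s) has_real_derivative ?v i - ?v j) (at_right t)"
      using phase_difference_derivative[OF sol ij \<open>t \<ge> 0\<close>] \<open>t \<ge> 0\<close>
      by (elim has_field_derivative_subset) auto
    then show "((case k of (i, j) \<Rightarrow> \<lambda>s. \<theta> i s - \<theta> j s) has_real_derivative
        (case k of (i, j) \<Rightarrow> ?v i - ?v j)) (at_right t)"
      by (simp add: k)
    assume "\<And>l. l \<in> ?I \<Longrightarrow> (case l of (i, j) \<Rightarrow> \<lambda>s. \<theta> i s - \<theta> j s) t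
        \<le> (case k of (i, j) \<Rightarrow> \<lambda>s. \<theta> i s - \<theta> j s) t"
    then have max: "\<theta> a t - \<theta> b t \<le> \<theta> i t - \<theta> j t" if "a < n" "b < n" for a b
      using that by (force simp: k)
    then have D: "lifted_diameter n \<theta> t = \<theta> i t - \<theta> j t"
      using ij phase_difference_le_lifted_diameter[OF ij, of \<theta> t] \<open>n > 0\<close>
      by (metis antisym lifted_diameter_attained)
    show "(case k of (i, j) \<Rightarrow> ?v i - ?v j)
        \<le> - 2 * attention_floor n \<beta> * sin (lifted_diameter n \<theta> t)"
      using extreme_pair_contracts[OF \<open>\<beta> \<ge> 0\<close> ij, of "\<lambda>k. \<theta> k t"] max small D
      by (simp add: k)
  qed (use \<open>n > 0\<close> in auto)
  moreover have "lifted_diameter n \<theta> =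
      (\<lambda>s. Max ((\<lambda>k. (case k of (i, j) \<Rightarrow> \<lambda>s. \<theta> i s - \<theta> j s) s) ` ?I))"
    by (rule ext) (simp add: lifted_diameter_eq_Max_pairs[OF \<open>n > 0\<close>] case_prod_beta')
  ultimately show ?thesis
    by simp
qed

lemma sin_double_arctan: "sin (2 * arctan y) = 2 * y / (1 + y\<^sup>2)"
proof -
  have "0 < 1 + y\<^sup>2"
    by (simp add: add_pos_nonneg)
  then have "sqrt (1 + y\<^sup>2) * sqrt (1 + y\<^sup>2) = 1 + y\<^sup>2"
    by simp
  then show ?thesis
    by (simp add: sin_double sin_arctan cos_arctan)
qed

lemma arctan_barrier_derivative:
  fixes K c t :: real
  shows "((\<lambda>t. 2 * arctan (K * exp (- c * t))) has_real_derivative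
            - c * sin (2 * arctan (K * exp (- c * t)))) (at t)"
  by (auto intro!: derivative_eq_intros simp: sin_double_arctan field_simps)

text \<open>
  The slack in both \<open>K\<close> and \<open>c\<close> makes the initial comparison and the slope comparison at a
  contact strict.
\<close>

lemma lifted_diameter_below_arctan_barrier:
  assumes "\<beta> \<ge> 0" "n > 0" and sol: "phase_flow_solution n \<beta> \<omega> p \<theta>"
    and small: "lifted_diameter n \<theta> 0 < pi"
    and K: "tan (lifted_diameter n \<theta> 0 / 2) < K"
    and c: "c < 2 * attention_floor n \<beta>"
    and t: "t \<ge> 0"
  shows "lifted_diameter n \<theta> t < 2 * arctan (K * exp (- c * t))"
proof -
  define u where "u s = 2 * arctan (K * exp (- c * s))" for s
  define v where "v s = phase_velocity n \<beta> \<omega> p (\<lambda>k. \<theta> k s)" for s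
  let ?I = "{..<n} \<times> {..<n}"
  let ?f = "\<lambda>(i, j) s. \<theta> i s - \<theta> j s"
  let ?d = "\<lambda>(i, j) s. v s i - v s j"
  have D0: "0 \<le> lifted_diameter n \<theta> 0"
    using lifted_diameter_nonneg[OF \<open>n > 0\<close>] .
  then have "0 \<le> tan (lifted_diameter n \<theta> 0 / 2)"
    using small by (cases "lifted_diameter n \<theta> 0 = 0") (auto intro!: less_imp_le tan_gt_zero)
  then have "K > 0"
    using K by simp
  have u_range: "0 < u s" "u s < pi" for s
    using \<open>K > 0\<close> arctan_ubound[of "K * exp (- c * s)"] by (auto simp: u_def)
  have "arctan (tan (lifted_diameter n \<theta> 0 / 2)) < arctan K"
    using K by (simp add: arctan_less_iff)
  then have init: "lifted_diameter n \<theta> 0 < u 0"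
    using D0 small by (simp add: u_def arctan_tan)
  have below: "?f k t < u t" if "k \<in> ?I" for k
  proof (rule finite_family_below_barrier[where f = ?f and d = ?d and u' = "\<lambda>s. - c * sin (u s)"])
    show "finite ?I" by simp
    show "k \<in> ?I" by fact
    show "t \<ge> 0" by fact
    show "(u has_real_derivative - c * sin (u s)) (at s)" for s
      unfolding u_def by (rule arctan_barrier_derivative)
  next
    fix k s assume "k \<in> ?I" and s: "s \<ge> (0::real)"
    then obtain i j where k: "k = (i, j)" and ij: "i < n" "j < n"
      by auto
    show "(?f k has_real_derivative ?d k s) (at s within {0..})"
      using phase_difference_derivative[OF sol ij s] by (simp add: k v_def)
    assume touch: "?f k s = u s" and max: "\<And>l. l \<in> ?I \<Longrightarrow> ?f l s \<le> u s"
    have "\<theta> a s - \<theta> b s \<le> \<theta> i s - \<theta> j s" if "a < n" "b < n" for a b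
      using max[of "(a, b)"] touch that by (simp add: k)
    then have "v s i - v s j \<le> - 2 * attention_floor n \<beta> * sin (u s)"
      using extreme_pair_contracts[OF \<open>\<beta> \<ge> 0\<close> ij, of "\<lambda>k. \<theta> k s"] u_range[of s] touch
      by (simp add: k v_def)
    also have "\<dots> < - c * sin (u s)"
      using c sin_gt_zero[OF u_range[of s]] by simp
    finally show "?d k s < - c * sin (u s)"
      by (simp add: k)
  next
    fix k assume "k \<in> ?I"
    then show "?f k 0 < u 0"
      using init phase_difference_le_lifted_diameter[of _ n _ \<theta> 0] by force
  qed
  obtain i j where "i < n" "j < n" "lifted_diameter n \<theta> t = \<theta> i t - \<theta> j t"
    using lifted_diameter_attained[OF \<open>n > 0\<close>] .
  then show ?thesis
    using below[of "(i, j)"] by (simp add: u_def)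
qed

theorem theorem6p3:
  fixes n :: nat and \<beta> \<omega> :: real and p :: "nat \<Rightarrow> real"
    and \<phi> \<theta> :: "nat \<Rightarrow> real \<Rightarrow> real"
  assumes "n \<ge> 2" and "\<beta> \<ge> 0"
    and "phase_flow_solution n \<beta> \<omega> p \<phi>"
    and "continuous_lifts n (\<lambda>i t. circle_point (\<phi> i t)) \<theta>"
    and "lifted_diameter n \<theta> 0 < pi"
  shows "\<forall>t\<ge>0.
      lifted_diameter n \<theta> t < pi \<and>
      upper_right_dini (lifted_diameter n \<theta>) t
        \<le> ereal (- 2 * attention_floor n \<beta> * sin (lifted_diameter n \<theta> t)) \<and>
      tan (lifted_diameter n \<theta> t / 2)
        \<le> tan (lifted_diameter n \<theta> 0 / 2) * exp (- 2 * attention_floor n \<beta> * t)"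
proof (intro allI impI)
  fix t :: real assume t: "t \<ge> 0"
  let ?D = "lifted_diameter n \<theta>"
  let ?a = "attention_floor n \<beta>"
  have "n > 0"
    using assms(1) by simp
  have sol: "phase_flow_solution n \<beta> \<omega> p \<theta>"
    using assms by (blast intro: continuous_lift_solves_phase_flow)
  have barrier: "?D t / 2 < arctan ((tan (?D 0 / 2) + e) * exp (- (2 * ?a - e) * t))"
    if "e > 0" for e
    using lifted_diameter_below_arctan_barrier[OF assms(2) \<open>n > 0\<close> sol assms(5) _ _ t,
        of "tan (?D 0 / 2) + e" "2 * ?a - e"] that
    by simp
  \<comment> \<open>Any barrier serves here, since all of them stay below \<open>pi\<close>.\<close>
  have D_lt: "?D t < pi"
    using barrier[of 1] arctan_ubound[of "(tan (?D 0 / 2) + 1) * exp (- (2 * ?a - 1) * t)"]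
    by simp
  \<comment> \<open>The same \<open>e\<close> is the slack in the initial value and in the rate; it tends to 0 below.\<close>
  have "tan (?D t / 2) < (tan (?D 0 / 2) + e) * exp (- (2 * ?a - e) * t)" if "e > 0" for e
  proof -
    have "- (pi / 2) < ?D t / 2"
      using lifted_diameter_nonneg[OF \<open>n > 0\<close>, of \<theta> t] pi_gt_zero by linarith
    then show ?thesis
      using tan_monotone[OF _ barrier[OF that] arctan_ubound] by (simp add: tan_arctan)
  qed
  then have "\<forall>\<^sub>F e in at_right 0.
      tan (?D t / 2) \<le> (tan (?D 0 / 2) + e) * exp (- (2 * ?a - e) * t)"
    by (auto simp: eventually_at_filter intro!: always_eventually less_imp_le)
  moreover have "((\<lambda>e. (tan (?D 0 / 2) + e) * exp (- (2 * ?a - e) * t)) \<longlongrightarrow>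
      (tan (?D 0 / 2) + 0) * exp (- (2 * ?a - 0) * t)) (at_right 0)"
    by (intro tendsto_intros)
  ultimately have "tan (?D t / 2) \<le> (tan (?D 0 / 2) + 0) * exp (- (2 * ?a - 0) * t)"
    by (intro tendsto_lowerbound) auto
  then show "?D t < pi \<and>
      upper_right_dini ?D t \<le> ereal (- 2 * ?a * sin (?D t)) \<and>
      tan (?D t / 2) \<le> tan (?D 0 / 2) * exp (- 2 * ?a * t)"
    using D_lt lifted_diameter_dini_le[OF assms(2) \<open>n > 0\<close> sol t D_lt] by simp
qed

end
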